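(* Let $k \ge 2$ be an integer and $n \ge k+1$. Then the maximum size of a family $\mathcal{F} \subseteq 2^{[n]}$ that contains neither $Y_k$ nor $Y'_k$ as an induced subposet equals $\Sigma(n,k)$; that is, $\mathrm{La}^{\sharp}(n, \{Y_k, Y'_k\}) = \Sigma(n,k)$.
   Context: $[n]=\{1,\dots,n\}$ and $2^{[n]}$ is ordered by inclusion. For an integer $k\ge 2$, the poset $Y_k$ (also written $Y_{k,2}$) consists of $k+2$ distinct elements $x_1,\dots,x_k,y_1,y_2$ with $x_1 < x_2 < \dots < x_k$ and $x_k < y_1$, $x_k < y_2$ (and the relations implied by transitivity; $y_1,y_2$ incomparable). $Y'_k$ is the dual (reversed) poset of $Y_k$. A poset $P$ is contained in a family $\mathcal{F}$ as an induced subposet if there is an injection $\alpha: P \to \mathcal{F}$ with $x_1 <_P x_2 \iff \alpha(x_1) \subsetneq \alpha(x_2)$ for all $x_1,x_2 \in P$. $\mathrm{La}^{\sharp}(n,\{P,Q\})$ is the maximum size of a family $\mathcal{F}\subseteq 2^{[n]}$ containing neither $P$ nor $Q$ as an induced subposet. $\Sigma(n,k)$ denotes the sum of the $k$ largest binomial coefficients $\binom{n}{i}$, $0\le i\le n$. *)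

theory Defs
  imports Complex_Main
begin

text \<open>A finite poset is represented as a carrier set together with its \<^emph>\<open>strict\<close> order relation.\<close>

type_synonym 'a spo = "'a set \<times> ('a \<times> 'a) set"

definition dual_poset :: "'a spo \<Rightarrow> 'a spo" where
  "dual_poset P = (fst P, (snd P)\<inverse>)"

definition contains_induced :: "'a spo \<Rightarrow> 'b set set \<Rightarrow> bool" where
  "contains_induced P F \<longleftrightarrow>
     (\<exists>\<alpha>. inj_on \<alpha> (fst P) \<and> \<alpha> ` fst P \<subseteq> F \<and>
        (\<forall>x \<in> fst P. \<forall>y \<in> fst P. (x, y) \<in> snd P \<longleftrightarrow> \<alpha> x \<subset> \<alpha> y))"

definition induced_free_families :: "nat \<Rightarrow> 'a spo set \<Rightarrow> nat set set set" where
  "induced_free_families n \<P> =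
     {F. F \<subseteq> Pow {1..n} \<and> (\<forall>P \<in> \<P>. \<not> contains_induced P F)}"

definition La_sharp :: "nat \<Rightarrow> 'a spo set \<Rightarrow> nat" where
  "La_sharp n \<P> = Max (card ` induced_free_families n \<P>)"

datatype Y_elem = Stem nat | Prong nat

text \<open>\<open>Stem i\<close> is $x_i$ and \<open>Prong j\<close> is $y_j$; the relation is already transitively closed.\<close>

definition Y_poset :: "nat \<Rightarrow> Y_elem spo" where
  "Y_poset k =
     (Stem ` {1..k} \<union> Prong ` {1, 2},
      {(Stem i, Stem j) | i j. 1 \<le> i \<and> i < j \<and> j \<le> k} \<union>
      Stem ` {1..k} \<times> Prong ` {1, 2})"

text \<open>Equal binomial coefficients with different lower index are counted separately.\<close>

definition sum_largest_binomials :: "nat \<Rightarrow> nat \<Rightarrow> nat" where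
  "sum_largest_binomials n k =
     sum_list (take k (rev (sort (map (\<lambda>i. n choose i) [0..<Suc n]))))"

lemma Y_poset_strict_order:
  "irrefl (snd (Y_poset k))" "trans (snd (Y_poset k))"
  "snd (Y_poset k) \<subseteq> fst (Y_poset k) \<times> fst (Y_poset k)"
  by (auto simp: Y_poset_def irrefl_def trans_def)

text \<open>The maximum in \<^const>\<open>La_sharp\<close> is over a finite nonempty set of sizes.\<close>

lemma finite_induced_free_families: "finite (induced_free_families n \<P>)"
  by (rule finite_subset[of _ "Pow (Pow {1..n})"]) (auto simp: induced_free_families_def)

lemma empty_in_induced_free_families:
  assumes "\<And>P. P \<in> \<P> \<Longrightarrow> fst P \<noteq> {}"
  shows "{} \<in> induced_free_families n \<P>"
  using assms by (auto simp: induced_free_families_def contains_induced_def)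

end

(*
  Upper bound: average |C \<inter> F| over all full chains C of the Boolean lattice.  If C meets F in more than
  k sets, |C \<inter> F| - k is the number of windows of k + 1 consecutive members of C \<inter> F.  Let x and y be
  the second and the second to last member of a window.  Y_k-freeness makes the members of F above y a
  chain, and Y'_k-freeness the members below x; hence one transposition of ground elements above y
  and one below x turn C into a full chain that meets F exactly in the k - 1 sets between x and y.  This
  map is injective, because x, y and thus the transpositions are read off the image, so the excess is
  paid for by chains meeting F in only k - 1 sets, provided F contains neither the empty set nor the
  full set.  A weighted LYM argument turns the average into a bound on |F|.

  If F contains the empty set, the rest G of F is Y_{k-1}-free, and the same argument with only the upper
  transposition bounds the average over G by k, with a deficit for every chain through a maximal member of
  G.  If F contains the full set as well, then for k \<ge> 3 the first argument applies to G with k - 1, and for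
  k = 2 either two maximal members of G give enough deficit or G is a chain.
*)
theory Submission
  imports Defs "HOL-Library.Multiset" "HOL-Combinatorics.Transposition"
begin

section \<open>Chains of sets under inclusion\<close>

lemma chain_subset_mono: "chain\<^sub>\<subseteq> C \<Longrightarrow> D \<subseteq> C \<Longrightarrow> chain\<^sub>\<subseteq> D"
  by (auto simp: chain_subset_def)

lemma chain_subsetD: "chain\<^sub>\<subseteq> C \<Longrightarrow> A \<in> C \<Longrightarrow> B \<in> C \<Longrightarrow> A \<subseteq> B \<or> B \<subseteq> A"
  by (auto simp: chain_subset_def)

text \<open>Rank each member by the number of members strictly below it: on a finite chain this rank
  is strictly monotone, hence a bijection onto an initial segment of the naturals, and
  \<open>e\<close> is its inverse.\<close>

lemma enumerate_chain:
  assumes "finite H" "chain\<^sub>\<subseteq> H"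
  obtains e where "bij_betw e {..<card H} H"
    "\<And>i j. i < card H \<Longrightarrow> j < card H \<Longrightarrow> e i \<subset> e j \<longleftrightarrow> i < j"
    "\<And>i j. i < card H \<Longrightarrow> j < card H \<Longrightarrow> e i \<subseteq> e j \<longleftrightarrow> i \<le> j"
proof -
  define r where "r z = card {w\<in>H. w \<subset> z}" for z
  have mono: "r z < r w" if "z \<in> H" "w \<in> H" "z \<subset> w" for z w
    unfolding r_def using assms(1) that by (intro psubset_card_mono) auto
  have inj: "inj_on r H"
  proof (rule inj_onI)
    fix z w assume zw: "z \<in> H" "w \<in> H" "r z = r w"
    then have "z \<subseteq> w \<or> w \<subseteq> z" using assms(2) by (auto simp: chain_subset_def)
    then show "z = w" using mono zw by (metis less_irrefl psubsetI)
  qed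
  have sub: "r ` H \<subseteq> {..<card H}"
    unfolding r_def using assms(1) by (auto intro!: psubset_card_mono)
  have "r ` H = {..<card H}"
    by (rule card_subset_eq) (use sub card_image[OF inj] in auto)
  with inj have bij: "bij_betw r H {..<card H}" by (simp add: bij_betw_def)
  define e where "e = the_inv_into H r"
  have e: "bij_betw e {..<card H} H" unfolding e_def by (rule bij_betw_the_inv_into[OF bij])
  have re: "r (e i) = i" if "i < card H" for i
    unfolding e_def using f_the_inv_into_f_bij_betw[OF bij] that by auto
  have eH: "e i \<in> H" if "i < card H" for i using e that by (auto simp: bij_betw_def)
  have lt: "e i \<subset> e j \<longleftrightarrow> i < j" if "i < card H" "j < card H" for i j
  proof
    assume "e i \<subset> e j" then show "i < j" using mono[of "e i" "e j"] re eH that by simp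
  next
    assume "i < j"
    then have "\<not> e j \<subset> e i" using mono[of "e j" "e i"] re eH that by auto
    moreover have "e i \<noteq> e j" using re that \<open>i < j\<close> by (metis less_irrefl)
    ultimately show "e i \<subset> e j" using eH that assms(2) unfolding chain_subset_def by blast
  qed
  have le: "e i \<subseteq> e j \<longleftrightarrow> i \<le> j" if "i < card H" "j < card H" for i j
  proof
    assume "e i \<subseteq> e j" then show "i \<le> j" using lt[of j i] that by (meson leI psubset_subset_trans psubset_imp_ex_mem psubsetE)
  next
    assume "i \<le> j" then show "e i \<subseteq> e j" using lt[of i j] that by (cases "i = j") auto
  qed
  show thesis using that e lt le by blast
qed

subsection \<open>Full chains\<close>

text \<open>For finite \<open>X\<close> these are the maximal chains of \<open>Pow X\<close>;
  prescribing the size instead of maximality yields one set on every level by counting.\<close>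

definition full_chains :: "'a set \<Rightarrow> 'a set set set" where
  "full_chains X = {C. C \<subseteq> Pow X \<and> chain\<^sub>\<subseteq> C \<and> card C = Suc (card X)}"

lemma finite_full_chains [simp]: "finite X \<Longrightarrow> finite (full_chains X)"
  by (rule finite_subset[of _ "Pow (Pow X)"]) (auto simp: full_chains_def)

lemma finite_full_chain: "C \<in> full_chains X \<Longrightarrow> finite C"
  by (rule card_ge_0_finite) (simp add: full_chains_def)

lemma card_inj_on_chain:
  assumes "chain\<^sub>\<subseteq> C" "C \<subseteq> Pow X" "finite X"
  shows "inj_on card C"
proof (rule inj_onI)
  fix A B assume AB: "A \<in> C" "B \<in> C" "card A = card B"
  then have "finite A" "finite B" using assms finite_subset by blast+
  moreover have "A \<subseteq> B \<or> B \<subseteq> A" using AB assms(1) by (auto simp: chain_subset_def)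
  ultimately show "A = B" using AB(3) by (metis card_subset_eq)
qed

lemma full_chain_level:
  assumes "finite X" "C \<in> full_chains X" "i \<le> card X"
  shows "\<exists>!A. A \<in> C \<and> card A = i"
proof -
  have C: "C \<subseteq> Pow X" "chain\<^sub>\<subseteq> C" "card C = Suc (card X)"
    using assms by (auto simp: full_chains_def)
  have inj: "inj_on card C" by (rule card_inj_on_chain[OF C(2,1) assms(1)])
  have "card ` C \<subseteq> {..card X}" using C(1) assms(1) by (auto intro: card_mono)
  then have "card ` C = {..card X}"
    by (intro card_subset_eq) (use card_image[OF inj] C(3) in auto)
  then have "i \<in> card ` C" using assms(3) by simp
  then show ?thesis using inj by (auto simp: inj_on_def)
qed

lemma full_chains_nonempty:
  assumes "finite X" shows "full_chains X \<noteq> {}"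
  using assms
proof (induction rule: finite_induct)
  case empty
  have "{{}} \<in> full_chains {}" by (auto simp: full_chains_def chain_subset_def)
  then show ?case by blast
next
  case (insert x X)
  then obtain C where C: "C \<in> full_chains X" by blast
  then have fin: "finite C" by (rule finite_full_chain)
  have "insert x X \<notin> C" using C insert by (auto simp: full_chains_def)
  then have "insert (insert x X) C \<in> full_chains (insert x X)"
    using C insert fin by (fastforce simp: full_chains_def chain_subset_def)
  then show ?case by blast
qed

lemma full_chains_image:
  assumes "bij_betw s X X" "C \<in> full_chains X"
  shows "(`) s ` C \<in> full_chains X"
proof -
  have C: "C \<subseteq> Pow X" "chain\<^sub>\<subseteq> C" "card C = Suc (card X)"
    using assms by (auto simp: full_chains_def)
  have "inj_on ((`) s) (Pow X)"
    using assms(1) by (simp add: bij_betw_def inj_on_image_Pow)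
  then have "card ((`) s ` C) = card C" using C(1) by (meson card_image inj_on_subset)
  moreover have "chain\<^sub>\<subseteq> ((`) s ` C)" using C(2) by (fastforce simp: chain_subset_def)
  moreover have "(`) s ` C \<subseteq> Pow X" using C(1) assms(1) by (auto simp: bij_betw_def)
  ultimately show ?thesis using C(3) by (simp add: full_chains_def)
qed

text \<open>A bijection from \<open>A\<close> to \<open>B\<close> glued to one between the
  complements is a permutation of \<open>X\<close>; it acts injectively on full chains and takes
  those through \<open>A\<close> to some through \<open>B\<close>. Exchanging \<open>A\<close> and
  \<open>B\<close> turns the inequality into an equality.\<close>

lemma card_chains_through_le:
  assumes "finite X" "A \<subseteq> X" "B \<subseteq> X" "card A = card B"
  shows "card {C \<in> full_chains X. A \<in> C} \<le> card {C \<in> full_chains X. B \<in> C}"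
proof -
  have fin: "finite A" "finite B" using assms finite_subset by blast+
  then obtain f where f: "bij_betw f A B" using assms(4) finite_same_card_bij by blast
  have "card (X - A) = card (X - B)" using assms fin by (simp add: card_Diff_subset)
  then obtain g where g: "bij_betw g (X - A) (X - B)"
    using assms(1) finite_same_card_bij by (metis finite_Diff)
  define s where "s z = (if z \<in> A then f z else g z)" for z
  have sA: "bij_betw s A B" using f by (rule bij_betw_cong[THEN iffD1, rotated]) (simp add: s_def)
  have sD: "bij_betw s (X - A) (X - B)"
    using g by (rule bij_betw_cong[THEN iffD1, rotated]) (simp add: s_def)
  have s: "bij_betw s X X"
    using bij_betw_combine[OF sA sD] assms(2,3) by (simp add: Un_absorb1 Diff_partition)
  show ?thesis
  proof (rule card_inj_on_le)
    show "inj_on ((`) ((`) s)) {C \<in> full_chains X. A \<in> C}"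
    proof (rule inj_on_subset)
      show "inj_on ((`) ((`) s)) (Pow (Pow X))"
        by (intro inj_on_image_Pow bij_betw_imp_inj_on[OF s])
      show "{C \<in> full_chains X. A \<in> C} \<subseteq> Pow (Pow X)" unfolding full_chains_def by blast
    qed
    show "(`) ((`) s) ` {C \<in> full_chains X. A \<in> C} \<subseteq> {C \<in> full_chains X. B \<in> C}"
    proof clarify
      fix C assume C: "C \<in> full_chains X" "A \<in> C"
      have "s ` A = B" using sA by (rule bij_betw_imp_surj_on)
      then show "(`) s ` C \<in> full_chains X \<and> B \<in> (`) s ` C"
        using full_chains_image[OF s C(1)] C(2) by blast
    qed
  qed (use assms in simp)
qed

text \<open>Count the pairs of a full chain and a member of size \<open>card A\<close> twice: each
  chain has one such member, and by symmetry each set of that size lies on equally many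
  chains.\<close>

lemma card_chains_through:
  assumes "finite X" "A \<subseteq> X"
  shows "card {C \<in> full_chains X. A \<in> C} * (card X choose card A) = card (full_chains X)"
proof -
  define i where "i = card A"
  define L where "L = {B. B \<subseteq> X \<and> card B = i}"
  have finL: "finite L" unfolding L_def using assms(1) by simp
  have eq: "card {C \<in> full_chains X. B \<in> C} = card {C \<in> full_chains X. A \<in> C}" if "B \<in> L" for B
    using that assms by (intro order_antisym card_chains_through_le) (auto simp: L_def i_def)
  have one: "card {B \<in> L. B \<in> C} = 1" if C: "C \<in> full_chains X" for C
  proof -
    have i: "i \<le> card X" unfolding i_def using assms by (simp add: card_mono)
    obtain B where B: "B \<in> C" "card B = i" "\<And>B'. B' \<in> C \<Longrightarrow> card B' = i \<Longrightarrow> B' = B"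
      using full_chain_level[OF assms(1) C i] by (elim ex1E) metis
    moreover have "B \<subseteq> X" using B(1) C by (auto simp: full_chains_def)
    ultimately have "{B \<in> L. B \<in> C} = {B}" unfolding L_def by blast
    then show ?thesis by simp
  qed
  have "card (full_chains X) = (\<Sum>C\<in>full_chains X. card {B \<in> L. B \<in> C})" by (simp add: one)
  also have "\<dots> = (\<Sum>B\<in>L. card {C \<in> full_chains X. B \<in> C})"
    using finL assms(1) by (intro sum_multicount_gen) auto
  also have "\<dots> = card L * card {C \<in> full_chains X. A \<in> C}" by (simp add: eq)
  also have "card L = card X choose i" unfolding L_def using n_subsets[OF assms(1)] by simp
  finally show ?thesis by (simp add: i_def mult.commute)
qed

text \<open>Double counting identifies the average of \<open>card (C \<inter> F)\<close> over all
  full chains with the LYM weight (Lubell function) of \<open>F\<close>.\<close>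

lemma sum_card_chain_Int:
  assumes "finite X" "F \<subseteq> Pow X"
  shows "real (\<Sum>C\<in>full_chains X. card (C \<inter> F)) =
    card (full_chains X) * (\<Sum>A\<in>F. 1 / real (card X choose card A))"
proof -
  have finF: "finite F" using assms finite_subset by blast
  have "(\<Sum>C\<in>full_chains X. card (C \<inter> F)) = (\<Sum>C\<in>full_chains X. card {A \<in> F. A \<in> C})"
    by (intro sum.cong refl arg_cong[where f = card]) auto
  also have "\<dots> = (\<Sum>A\<in>F. card {C \<in> full_chains X. A \<in> C})"
    using finF assms(1) by (intro sum_multicount_gen) auto
  finally have "real (\<Sum>C\<in>full_chains X. card (C \<inter> F)) = (\<Sum>A\<in>F. real (card {C \<in> full_chains X. A \<in> C}))"
    by simp
  also have "\<dots> = (\<Sum>A\<in>F. card (full_chains X) * (1 / real (card X choose card A)))"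
  proof (rule sum.cong[OF refl])
    fix A assume "A \<in> F"
    then have A: "A \<subseteq> X" using assms by blast
    then have "card X choose card A > 0" using assms(1) by (simp add: card_mono zero_less_binomial)
    then show "real (card {C \<in> full_chains X. A \<in> C}) = card (full_chains X) * (1 / real (card X choose card A))"
      using card_chains_through[OF assms(1) A, symmetric] by simp
  qed
  finally show ?thesis by (simp add: sum_distrib_left)
qed

subsection \<open>Swapping a chain away from a family\<close>

text \<open>The involution \<open>s\<close> moves only elements of \<open>R - L\<close>, so sets
  below \<open>L\<close> or above \<open>R\<close> stay put. One \<open>s\<close> serves all chains
  \<open>C\<close>: it can be chosen from \<open>L\<close>, \<open>R\<close> and \<open>H\<close>
  alone, which later allows it to be recovered from the image of a chain.\<close>

definition avoids :: "('a \<Rightarrow> 'a) \<Rightarrow> 'a set \<Rightarrow> 'a set \<Rightarrow> 'a set set \<Rightarrow> bool" where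
  "avoids s L R H \<longleftrightarrow> (\<forall>z. s (s z) = z) \<and> (\<forall>z. z \<notin> R - L \<longrightarrow> s z = z) \<and>
    (\<forall>C. chain\<^sub>\<subseteq> C \<longrightarrow> C \<inter> H \<noteq> {} \<longrightarrow> (`) s ` C \<inter> H = {})"

text \<open>If \<open>c\<close> lies in every member of \<open>H\<close> and \<open>d\<close> in none, a chain meeting \<open>H\<close> picks up \<open>c\<close> before \<open>d\<close>;
  after transposing \<open>c\<close> and \<open>d\<close> it can no longer meet \<open>H\<close>.\<close>

lemma ex_avoids:
  assumes "finite H" "chain\<^sub>\<subseteq> H" "\<And>h. h \<in> H \<Longrightarrow> L \<subset> h \<and> h \<subset> R"
  shows "\<exists>s. avoids s L R H"
proof (cases "H = {}")
  case True
  then show ?thesis by (intro exI[of _ id]) (auto simp: avoids_def)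
next
  case False
  have "subset.chain UNIV H" using assms(2) by (auto simp: subset_chain_def chain_subset_def)
  then have "\<Inter>H \<in> H" "\<Union>H \<in> H"
    using False assms(1) by (auto intro: Inter_in_chain Union_in_chain)
  then have "L \<subset> \<Inter>H" "\<Union>H \<subset> R" using assms(3) by blast+
  then obtain c d where cd: "c \<in> \<Inter>H" "c \<notin> L" "d \<in> R" "d \<notin> \<Union>H" by blast
  have "c \<in> R" "d \<notin> L" using cd \<open>\<Inter>H \<in> H\<close> \<open>\<Union>H \<in> H\<close> assms(3) by blast+
  note cd = cd this
  define s where "s = transpose c d"
  have mem: "d \<in> P \<and> c \<notin> P" if "s ` P \<in> H" for P
  proof -
    have "c \<in> s ` P" "d \<notin> s ` P" using that cd by auto
    moreover have "c \<in> s ` P \<longleftrightarrow> d \<in> P" "d \<in> s ` P \<longleftrightarrow> c \<in> P"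
      by (auto simp: s_def transpose_def image_iff)
    ultimately show ?thesis by simp
  qed
  show ?thesis
    unfolding avoids_def
  proof (intro exI[of _ s] conjI allI impI)
    \<comment> \<open>Some \<open>h\<close> in \<open>C\<close> contains \<open>c\<close> but not
      \<open>d\<close>, while by \<open>mem\<close> a set mapped into \<open>H\<close> contains
      \<open>d\<close> but not \<open>c\<close>; the two are incomparable and cannot both lie in
      \<open>C\<close>.\<close>
    fix C assume C: "chain\<^sub>\<subseteq> C" "C \<inter> H \<noteq> {}"
    then obtain h where h: "h \<in> C" "h \<in> H" by blast
    then have "c \<in> h" "d \<notin> h" using cd by auto
    then show "(`) s ` C \<inter> H = {}" using C(1) h mem unfolding chain_subset_def by blast
  next
    fix z show "s (s z) = z" by (simp add: s_def)
  next
    fix z assume "z \<notin> R - L"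
    then have "z \<noteq> c" "z \<noteq> d" using cd by blast+
    then show "s z = z" by (simp add: s_def transpose_def)
  qed
qed

text \<open>The map \<open>s\<close> permutes \<open>R - L\<close> and fixes everything else, and
  \<open>P\<close> either misses \<open>R - L\<close> or contains all of it.\<close>

lemma swap_image_eq:
  assumes "\<And>z. s (s z) = z" "\<And>z. z \<notin> R - L \<Longrightarrow> s z = z" "P \<subseteq> L \<or> R \<subseteq> P"
  shows "s ` P = P"
proof -
  have "s z \<in> R - L" if "z \<in> R - L" for z using assms(1,2) that by metis
  then have "s ` P \<subseteq> P" using assms(2,3) by fastforce
  moreover then have "s ` s ` P \<subseteq> s ` P" by blast
  then have "P \<subseteq> s ` P" using assms(1) by (simp add: image_image)
  ultimately show ?thesis by blast
qed

lemma swap_bij_betw: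
  assumes "\<And>z. s (s z) = z" "\<And>z. z \<notin> R - L \<Longrightarrow> s z = z" "R \<subseteq> X"
  shows "bij_betw s X X"
proof (rule bij_betw_imageI)
  show "inj_on s X" by (rule inj_on_inverseI) (rule assms(1))
  show "s ` X = X" by (rule swap_image_eq[of s R L]) (use assms in auto)
qed

lemma swap_image_mem_iff:
  assumes "\<And>z. s (s z) = z" "\<And>z. z \<notin> R - L \<Longrightarrow> s z = z" "P \<subseteq> L \<or> R \<subseteq> P"
  shows "P \<in> (`) s ` C \<longleftrightarrow> P \<in> C"
proof -
  have eq: "s ` P = P" using swap_image_eq assms by blast
  have "Q = P" if "s ` Q = P" for Q
  proof -
    have "Q = s ` s ` Q" using assms(1) by (simp add: image_image)
    then show ?thesis using that eq by simp
  qed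
  then show ?thesis using eq by (metis (no_types) imageE image_eqI)
qed

lemma swap_swap_image:
  assumes "\<And>z. s (s z) = z"
  shows "(`) s ` (`) s ` C = C"
  using assms by (simp add: image_image)

lemma avoids_mem_iff: "avoids s L R H \<Longrightarrow> P \<subseteq> L \<or> R \<subseteq> P \<Longrightarrow> P \<in> (`) s ` C \<longleftrightarrow> P \<in> C"
  unfolding avoids_def by (intro swap_image_mem_iff[of s R L]) auto

lemma avoids_involution: "avoids s L R H \<Longrightarrow> (`) s ` (`) s ` C = C"
  unfolding avoids_def by (intro swap_swap_image) auto

lemma avoids_full_chain:
  "avoids s L R H \<Longrightarrow> R \<subseteq> X \<Longrightarrow> C \<in> full_chains X \<Longrightarrow> (`) s ` C \<in> full_chains X"
  unfolding avoids_def by (intro full_chains_image swap_bij_betw[of s R L]) auto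

lemma avoids_Int: "avoids s L R H \<Longrightarrow> chain\<^sub>\<subseteq> C \<Longrightarrow> C \<inter> H \<noteq> {} \<Longrightarrow> (`) s ` C \<inter> H = {}"
  unfolding avoids_def by blast

subsection \<open>Counting windows\<close>

text \<open>The set \<open>y\<close> is the top of a chain of \<open>k\<close> members, the image of
  the stem of \<open>Y_k\<close>; two incomparable members above \<open>y\<close> would serve as
  prongs. In this form freeness supplies the chain that a transposition can clear.\<close>

definition fork_free :: "nat \<Rightarrow> 'a set set \<Rightarrow> bool" where
  "fork_free k F \<longleftrightarrow> (\<forall>S y. S \<subseteq> F \<longrightarrow> chain\<^sub>\<subseteq> S \<longrightarrow> card S = k \<longrightarrow> y \<in> S \<longrightarrow> (\<forall>s\<in>S. s \<subseteq> y) \<longrightarrow>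
     chain\<^sub>\<subseteq> {h\<in>F. y \<subset> h})"

definition cofork_free :: "nat \<Rightarrow> 'a set set \<Rightarrow> bool" where
  "cofork_free k F \<longleftrightarrow> (\<forall>S x. S \<subseteq> F \<longrightarrow> chain\<^sub>\<subseteq> S \<longrightarrow> card S = k \<longrightarrow> x \<in> S \<longrightarrow> (\<forall>s\<in>S. x \<subseteq> s) \<longrightarrow>
     chain\<^sub>\<subseteq> {h\<in>F. h \<subset> x})"

text \<open>The extra condition asks for a further member of \<open>H\<close> above the window.\<close>

definition windows :: "nat \<Rightarrow> 'a set set \<Rightarrow> ('a set \<times> 'a set) set" where
  "windows m H = {(x, y). x \<in> H \<and> y \<in> H \<and> x \<subseteq> y \<and> card {z\<in>H. x \<subseteq> z \<and> z \<subseteq> y} = m \<and> (\<exists>h\<in>H. y \<subset> h)}"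

lemma finite_windows: "finite H \<Longrightarrow> finite (windows m H)"
  by (rule finite_subset[of _ "H \<times> H"]) (auto simp: windows_def)

text \<open>For each \<open>i < card H - m\<close> the interval from \<open>e i\<close> to
  \<open>e (i + m - 1)\<close> has \<open>m\<close> members, and \<open>e (i + m)\<close> lies above
  it. Starting at \<open>i = 1\<close> also leaves \<open>e 0\<close> below, at the price of one
  window. If \<open>card H\<close> is at most \<open>m\<close>, the bounds are trivial.\<close>

lemma card_le_windows:
  assumes "finite H" "chain\<^sub>\<subseteq> H" "m \<ge> 1"
  shows "card H \<le> m + card (windows m H)"
    and "card H \<le> Suc m + card {(x, y) \<in> windows m H. \<exists>f\<in>H. f \<subset> x}"
proof -
  obtain e where e: "bij_betw e {..<card H} H"
    and lt: "\<And>i j. i < card H \<Longrightarrow> j < card H \<Longrightarrow> e i \<subset> e j \<longleftrightarrow> i < j"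
    and le: "\<And>i j. i < card H \<Longrightarrow> j < card H \<Longrightarrow> e i \<subseteq> e j \<longleftrightarrow> i \<le> j"
    using enumerate_chain[OF assms(1,2)] by blast
  define g where "g i = (e i, e (i + m - 1))" for i
  have eH: "e i \<in> H" if "i < card H" for i using e that by (auto simp: bij_betw_def)
  have inj_e: "inj_on e {..<card H}" using e by (simp add: bij_betw_def)
  have inj: "inj_on g {..<card H - m}"
    by (rule inj_onI) (use inj_e in \<open>auto simp: g_def inj_on_def\<close>)
  have win: "g i \<in> windows m H" if "i < card H - m" for i
  proof -
    have i: "i < card H" "i + m - 1 < card H" "i + m < card H" using that assms(3) by auto
    have "{z\<in>H. e i \<subseteq> z \<and> z \<subseteq> e (i + m - 1)} = e ` {i..i + m - 1}"
    proof (intro equalityI subsetI)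
      fix z assume z: "z \<in> {z\<in>H. e i \<subseteq> z \<and> z \<subseteq> e (i + m - 1)}"
      then have "z \<in> e ` {..<card H}" using e by (simp add: bij_betw_def)
      then obtain l where l: "l < card H" "z = e l" by auto
      then have "i \<le> l" "l \<le> i + m - 1" using le[of i l] le[of l "i + m - 1"] z i by auto
      then show "z \<in> e ` {i..i + m - 1}" using l by auto
    next
      fix z assume "z \<in> e ` {i..i + m - 1}"
      then obtain l where l: "i \<le> l" "l \<le> i + m - 1" "z = e l" by auto
      then show "z \<in> {z\<in>H. e i \<subseteq> z \<and> z \<subseteq> e (i + m - 1)}"
        using le[of i l] le[of l "i + m - 1"] i eH[of l] by auto
    qed
    moreover have "card (e ` {i..i + m - 1}) = m"
      using i assms(3) by (subst card_image) (auto intro!: inj_on_subset[OF inj_e])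
    moreover have "e (i + m - 1) \<subset> e (i + m)" using lt[of "i + m - 1" "i + m"] i assms(3) by simp
    moreover have "e i \<subseteq> e (i + m - 1)" using le[of i "i + m - 1"] i assms(3) by simp
    ultimately show ?thesis unfolding g_def windows_def mem_Collect_eq prod.case
      by (intro conjI bexI[of _ "e (i + m)"] eH i) simp_all
  qed
  have "card {..<card H - m} \<le> card (windows m H)"
    using win finite_windows[OF assms(1)] by (intro card_inj_on_le[OF inj]) auto
  then show "card H \<le> m + card (windows m H)" by simp
  have "card {1..<card H - m} \<le> card {(x, y) \<in> windows m H. \<exists>f\<in>H. f \<subset> x}"
  proof (rule card_inj_on_le)
    show "inj_on g {1..<card H - m}" by (rule inj_on_subset[OF inj]) auto
    show "g ` {1..<card H - m} \<subseteq> {(x, y) \<in> windows m H. \<exists>f\<in>H. f \<subset> x}"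
    proof (rule image_subsetI)
      fix i assume i: "i \<in> {1..<card H - m}"
      then have "0 < i" "i < card H" by auto
      then have "e 0 \<subset> e i" "e 0 \<in> H" using lt[of 0 i] eH[of 0] by simp_all
      then show "g i \<in> {(x, y) \<in> windows m H. \<exists>f\<in>H. f \<subset> x}"
        using win[of i] i by (auto simp: g_def)
    qed
    show "finite {(x, y) \<in> windows m H. \<exists>f\<in>H. f \<subset> x}"
      by (rule finite_subset[OF _ finite_windows[OF assms(1), of m]]) auto
  qed
  then show "card H \<le> Suc m + card {(x, y) \<in> windows m H. \<exists>f\<in>H. f \<subset> x}" by simp
qed

text \<open>The excess of \<open>card (C \<inter> G)\<close> over \<open>j\<close> is at most the
  number of \<open>j\<close>-windows. Clearing all of \<open>G\<close> above the top of a window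
  maps the pairs of a chain and a window injectively to full chains that contain no maximal member
  of \<open>G\<close>, so the total excess is at most the number of these chains.\<close>

lemma fork_free_chain_count:
  assumes "finite X" "G \<subseteq> Pow X" "X \<notin> G" "fork_free j G" "j \<ge> 1"
  shows "(\<Sum>C\<in>full_chains X. card (C \<inter> G)) + card {C \<in> full_chains X. \<exists>y\<in>C \<inter> G. \<forall>h\<in>G. \<not> y \<subset> h}
    \<le> Suc j * card (full_chains X)"
proof -
  define T where "T = full_chains X"
  define M where "M = {C \<in> T. \<exists>y\<in>C \<inter> G. \<forall>h\<in>G. \<not> y \<subset> h}"
  define W where "W = Sigma T (\<lambda>C. windows j (C \<inter> G))"
  have finT: "finite T" using assms(1) by (simp add: T_def)
  have finG: "finite G" using assms(1,2) finite_subset by blast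
  have chain: "chain\<^sub>\<subseteq> C" if "C \<in> T" for C using that by (simp add: T_def full_chains_def)
  have ex: "\<exists>s. avoids s y X {h\<in>G. y \<subset> h}" if "(C, x, y) \<in> W" for C x y
  proof (rule ex_avoids)
    let ?S = "{z \<in> C \<inter> G. x \<subseteq> z \<and> z \<subseteq> y}"
    have w: "C \<in> T" "x \<in> C \<inter> G" "y \<in> C \<inter> G" "x \<subseteq> y" "card ?S = j"
      using that by (auto simp: W_def windows_def)
    have "?S \<subseteq> G" "chain\<^sub>\<subseteq> ?S" "y \<in> ?S" "\<forall>s\<in>?S. s \<subseteq> y"
      using w by (auto intro: chain_subset_mono[OF chain[OF w(1)]])
    then show "chain\<^sub>\<subseteq> {h\<in>G. y \<subset> h}" using assms(4) w(5) unfolding fork_free_def by blast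
    show "finite {h\<in>G. y \<subset> h}" using finG by simp
    \<comment> \<open>Strictness at \<open>X\<close>, which is where \<open>X \<notin> G\<close>
      enters, leaves an element outside the largest such \<open>h\<close> for the
      transposition.\<close>
    show "y \<subset> h \<and> h \<subset> X" if "h \<in> {h\<in>G. y \<subset> h}" for h
      using that assms(2,3) by blast
  qed
  \<comment> \<open>The choice depends on \<open>y\<close> only, and \<open>y\<close> will be read
    off the image chain by \<open>top\<close>, so the swap can be undone.\<close>
  define u where "u y = (SOME s. avoids s y X {h\<in>G. y \<subset> h})" for y
  have u: "avoids (u y) y X {h\<in>G. y \<subset> h}" if "(C, x, y) \<in> W" for C x y
    unfolding u_def using ex[OF that] by (rule someI_ex)
  define f where "f = (\<lambda>(C, x :: 'a set, y). (`) (u y) ` C)"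
  have key: "f (C, x, y) \<in> T \<and> f (C, x, y) \<inter> G = {z \<in> C \<inter> G. z \<subseteq> y}" if "(C, x, y) \<in> W" for C x y
  proof -
    have w: "C \<in> T" "y \<in> C \<inter> G" "\<exists>h\<in>C \<inter> G. y \<subset> h"
      using that by (auto simp: W_def windows_def)
    note a = u[OF that]
    have T: "f (C, x, y) \<in> T"
      using avoids_full_chain[OF a] w(1) by (simp add: f_def T_def)
    have iff: "P \<in> f (C, x, y) \<longleftrightarrow> P \<in> C" if "P \<subseteq> y" for P
      using avoids_mem_iff[OF a] that by (simp add: f_def)
    have e: "f (C, x, y) \<inter> {h\<in>G. y \<subset> h} = {}"
      unfolding f_def prod.case by (rule avoids_Int[OF a chain[OF w(1)]]) (use w(3) in blast)
    have sub: "P \<subseteq> y" if "P \<in> f (C, x, y)" "P \<in> G" for P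
    proof -
      have "P \<subseteq> y \<or> y \<subset> P"
        using chain[OF T] that(1) iff[of y] w(2) unfolding chain_subset_def by blast
      then show ?thesis using e that by blast
    qed
    have "f (C, x, y) \<inter> G = {z \<in> C \<inter> G. z \<subseteq> y}"
    proof (rule set_eqI)
      fix P show "P \<in> f (C, x, y) \<inter> G \<longleftrightarrow> P \<in> {z \<in> C \<inter> G. z \<subseteq> y}"
        using iff[of P] sub[of P] by blast
    qed
    then show ?thesis using T by simp
  qed
  have top: "\<Union>(f (C, x, y) \<inter> G) = y" if "(C, x, y) \<in> W" for C x y
    using key[OF that] that by (auto simp: W_def windows_def)
  have "inj_on f W"
  proof (rule inj_onI)
    fix p q assume pq: "p \<in> W" "q \<in> W" "f p = f q"
    obtain C x y C' x' y' where p: "p = (C, x, y)" "q = (C', x', y')"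
      by (cases p, cases q)
    then have w: "(C, x, y) \<in> W" "(C', x', y') \<in> W" and eq: "f (C, x, y) = f (C', x', y')"
      using pq by simp_all
    have y: "y = y'" using top[OF w(1)] top[OF w(2)] eq by simp
    define D where "D = f (C, x, y)"
    have D: "D = (`) (u y) ` C" "D = (`) (u y) ` C'" using eq y by (auto simp: D_def f_def)
    have C: "C = C'" using avoids_involution[OF u[OF w(1)]] D by metis
    define H where "H = C \<inter> G"
    have H: "x \<in> H" "x' \<in> H" "x \<subseteq> y" "x' \<subseteq> y"
      "card {z\<in>H. x \<subseteq> z \<and> z \<subseteq> y} = j" "card {z\<in>H. x' \<subseteq> z \<and> z \<subseteq> y} = j"
      using w C y by (auto simp: W_def windows_def H_def)
    have finH: "finite H" using finG by (simp add: H_def)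
    \<comment> \<open>With \<open>C\<close> and \<open>y\<close> known, the bottom of the window is
      determined: moving it strictly down increases the number of members in between.\<close>
    have "\<not> a \<subset> b" if "a \<in> H" "b \<in> H" "a \<subseteq> y" "card {z\<in>H. a \<subseteq> z \<and> z \<subseteq> y} = j"
      "card {z\<in>H. b \<subseteq> z \<and> z \<subseteq> y} = j" for a b
    proof
      assume "a \<subset> b"
      then have "{z\<in>H. b \<subseteq> z \<and> z \<subseteq> y} \<subset> {z\<in>H. a \<subseteq> z \<and> z \<subseteq> y}" using that by blast
      then have "card {z\<in>H. b \<subseteq> z \<and> z \<subseteq> y} < card {z\<in>H. a \<subseteq> z \<and> z \<subseteq> y}"
        using finH by (intro psubset_card_mono) auto
      then show False using that by simp
    qed
    then have "\<not> x \<subset> x'" "\<not> x' \<subset> x" using H by blast+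
    moreover have "x \<subseteq> x' \<or> x' \<subseteq> x"
      using chain[of C] w H(1,2) unfolding chain_subset_def H_def W_def by blast
    ultimately have "x = x'" by blast
    then show "p = q" using C y p by simp
  qed
  moreover have "f ` W \<subseteq> T - M"
  proof (rule image_subsetI)
    fix p assume "p \<in> W"
    then obtain C x y where p: "p = (C, x, y)" and w: "(C, x, y) \<in> W" by (cases p) blast
    then have "\<exists>h\<in>G. y \<subset> h" by (auto simp: W_def windows_def)
    then show "f p \<in> T - M" using key[OF w] unfolding M_def p by blast
  qed
  ultimately have "card W \<le> card (T - M)" using finT by (meson card_inj_on_le finite_Diff)
  moreover have "M \<subseteq> T" by (auto simp: M_def)
  ultimately have WM: "card W + card M \<le> card T"
    using finT by (metis add_le_mono1 card_Diff_subset card_mono finite_subset le_add_diff_inverse2)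
  have fin: "finite (C \<inter> G)" for C using finG by simp
  have "(\<Sum>C\<in>T. card (C \<inter> G)) \<le> (\<Sum>C\<in>T. j + card (windows j (C \<inter> G)))"
    using fin chain by (intro sum_mono card_le_windows assms(5)) (auto intro: chain_subset_mono)
  also have "\<dots> = j * card T + card W"
    unfolding W_def using finT finite_windows[OF fin] by (simp add: sum.distrib card_SigmaI)
  finally show ?thesis using WM unfolding M_def T_def by simp
qed

text \<open>Windows of \<open>k - 1\<close> members with further members of
  \<open>C \<inter> F\<close> on both sides number at least \<open>card (C \<inter> F) - k\<close>.
  Clearing both sides maps them injectively to chains meeting \<open>F\<close> in exactly
  \<open>k - 1\<close> sets, each of which falls one short of \<open>k\<close>.\<close>

lemma fork_cofork_free_chain_count:
  assumes "finite X" "F \<subseteq> Pow X" "X \<notin> F" "{} \<notin> F" "fork_free k F" "cofork_free k F" "k \<ge> 2"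
  shows "(\<Sum>C\<in>full_chains X. card (C \<inter> F)) \<le> k * card (full_chains X)"
proof -
  define m where "m = k - 1"
  have m: "m \<ge> 1" "k = Suc m" using assms(7) by (auto simp: m_def)
  define T where "T = full_chains X"
  define W where "W = Sigma T (\<lambda>C. {(x, y) \<in> windows m (C \<inter> F). \<exists>f\<in>C \<inter> F. f \<subset> x})"
  have finT: "finite T" using assms(1) by (simp add: T_def)
  have finF: "finite F" using assms(1,2) finite_subset by blast
  have fin: "finite (C \<inter> F)" for C using finF by simp
  have chain: "chain\<^sub>\<subseteq> C" if "C \<in> T" for C using that by (simp add: T_def full_chains_def)
  have ex: "\<exists>s. avoids s y X {h\<in>F. y \<subset> h}" "\<exists>s. avoids s {} x {h\<in>F. h \<subset> x}"
    if "(C, x, y) \<in> W" for C x y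
  proof -
    let ?S = "{z \<in> C \<inter> F. x \<subseteq> z \<and> z \<subseteq> y}"
    have w: "C \<in> T" "x \<in> C \<inter> F" "y \<in> C \<inter> F" "x \<subseteq> y" "card ?S = m"
      using that by (auto simp: W_def windows_def)
    have "\<exists>a\<in>C \<inter> F. a \<subset> x" "\<exists>b\<in>C \<inter> F. y \<subset> b"
      using that by (simp_all add: W_def windows_def)
    then obtain a b where ab: "a \<in> C \<inter> F" "a \<subset> x" "b \<in> C \<inter> F" "y \<subset> b" by blast
    have finS: "finite ?S" using finF by simp
    have "a \<notin> ?S" "b \<notin> ?S" using ab by blast+
    \<comment> \<open>The window together with \<open>a\<close> is a chain of \<open>k\<close>
      members with top \<open>y\<close>, and together with \<open>b\<close> one with bottom
      \<open>x\<close>, so both freeness hypotheses apply.\<close>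
    then have card: "card (insert a ?S) = k" "card (insert b ?S) = k"
      using finS w(5) m by simp_all
    have "chain\<^sub>\<subseteq> (insert a ?S)" "chain\<^sub>\<subseteq> (insert b ?S)"
      using ab by (auto intro!: chain_subset_mono[OF chain[OF w(1)]])
    moreover have "insert a ?S \<subseteq> F" "y \<in> insert a ?S" "\<forall>s\<in>insert a ?S. s \<subseteq> y"
      "insert b ?S \<subseteq> F" "x \<in> insert b ?S" "\<forall>s\<in>insert b ?S. x \<subseteq> s"
      using w ab by blast+
    ultimately have ch: "chain\<^sub>\<subseteq> {h\<in>F. y \<subset> h}" "chain\<^sub>\<subseteq> {h\<in>F. h \<subset> x}"
      using assms(5,6) card unfolding fork_free_def cofork_free_def by blast+
    show "\<exists>s. avoids s y X {h\<in>F. y \<subset> h}"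
      using ch(1) finF assms(2,3) by (intro ex_avoids) auto
    show "\<exists>s. avoids s {} x {h\<in>F. h \<subset> x}"
      using ch(2) finF assms(4) by (intro ex_avoids) auto
  qed
  define u where "u y = (SOME s. avoids s y X {h\<in>F. y \<subset> h})" for y
  define l where "l x = (SOME s. avoids s {} x {h\<in>F. h \<subset> x})" for x
  have u: "avoids (u y) y X {h\<in>F. y \<subset> h}" if "(C, x, y) \<in> W" for C x y
    unfolding u_def using ex(1)[OF that] by (rule someI_ex)
  have l: "avoids (l x) {} x {h\<in>F. h \<subset> x}" if "(C, x, y) \<in> W" for C x y
    unfolding l_def using ex(2)[OF that] by (rule someI_ex)
  define f where "f = (\<lambda>(C, x, y). (`) (u y) ` (`) (l x) ` C)"
  have key: "f (C, x, y) \<in> T \<and> f (C, x, y) \<inter> F = {z \<in> C \<inter> F. x \<subseteq> z \<and> z \<subseteq> y}"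
    if "(C, x, y) \<in> W" for C x y
  proof -
    have w: "C \<in> T" "x \<in> C \<inter> F" "y \<in> C \<inter> F" "x \<subseteq> y"
      using that by (auto simp: W_def windows_def)
    have "\<exists>a\<in>C \<inter> F. a \<subset> x" "\<exists>b\<in>C \<inter> F. y \<subset> b"
      using that by (simp_all add: W_def windows_def)
    then obtain a b where ab: "a \<in> C \<inter> F" "a \<subset> x" "b \<in> C \<inter> F" "y \<subset> b" by blast
    have xX: "x \<subseteq> X" using w(2) assms(2) by blast
    define C1 where "C1 = (`) (l x) ` C"
    define C2 where "C2 = (`) (u y) ` C1"
    have C1: "C1 \<in> T" using avoids_full_chain[OF l[OF that] xX] w(1) by (simp add: C1_def T_def)
    have C2: "C2 \<in> T" using avoids_full_chain[OF u[OF that]] C1 by (simp add: C2_def T_def)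
    have iff1: "P \<in> C1 \<longleftrightarrow> P \<in> C" if "x \<subseteq> P" for P
      using avoids_mem_iff[OF l[OF \<open>(C, x, y) \<in> W\<close>]] that by (simp add: C1_def)
    have iff2: "P \<in> C2 \<longleftrightarrow> P \<in> C1" if "P \<subseteq> y" for P
      using avoids_mem_iff[OF u[OF \<open>(C, x, y) \<in> W\<close>]] that by (simp add: C2_def)
    have e1: "C1 \<inter> {h\<in>F. h \<subset> x} = {}"
      unfolding C1_def by (rule avoids_Int[OF l[OF that] chain[OF w(1)]]) (use ab in blast)
    \<comment> \<open>The lower swap keeps all sets above \<open>x\<close>; hence \<open>C1\<close>
      still meets the members of \<open>F\<close> above \<open>y\<close>, as clearing by
      \<open>u y\<close> requires.\<close>
    have "b \<in> C1" using iff1[of b] ab w(4) by blast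
    then have e2: "C2 \<inter> {h\<in>F. y \<subset> h} = {}"
      unfolding C2_def using ab by (intro avoids_Int[OF u[OF that] chain[OF C1]]) blast
    have "x \<in> C2" "y \<in> C2" using iff1 iff2 w by blast+
    then have "(P \<subseteq> x \<or> x \<subseteq> P) \<and> (P \<subseteq> y \<or> y \<subseteq> P)" if "P \<in> C2" for P
      using chain[OF C2] that unfolding chain_subset_def by blast
    note comp = this
    have sub: "x \<subseteq> P \<and> P \<subseteq> y" if P: "P \<in> C2" "P \<in> F" for P
    proof -
      have "\<not> y \<subset> P" using e2 P by blast
      then have y: "P \<subseteq> y" using comp[OF P(1)] by blast
      \<comment> \<open>Being contained in \<open>y\<close>, the set \<open>P\<close> is not
        affected by the upper swap: it belongs to \<open>C1\<close>, which has no member of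
        \<open>F\<close> strictly below \<open>x\<close>.\<close>
      then have "\<not> P \<subset> x" using e1 P iff2 by blast
      then show ?thesis using y comp[OF P(1)] by blast
    qed
    have "C2 \<inter> F = {z \<in> C \<inter> F. x \<subseteq> z \<and> z \<subseteq> y}"
    proof (rule set_eqI)
      fix P show "P \<in> C2 \<inter> F \<longleftrightarrow> P \<in> {z \<in> C \<inter> F. x \<subseteq> z \<and> z \<subseteq> y}"
        using iff1[of P] iff2[of P] sub[of P] by blast
    qed
    then show ?thesis using C2 by (simp add: f_def C1_def C2_def)
  qed
  have "inj_on f W"
  proof (rule inj_onI)
    fix p q assume pq: "p \<in> W" "q \<in> W" "f p = f q"
    obtain C x y C' x' y' where p: "p = (C, x, y)" "q = (C', x', y')"
      by (cases p, cases q)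
    then have w: "(C, x, y) \<in> W" "(C', x', y') \<in> W" and eq: "f (C, x, y) = f (C', x', y')"
      using pq by simp_all
    have ends: "\<Union>(f (C, x, y) \<inter> F) = y \<and> \<Inter>(f (C, x, y) \<inter> F) = x" if "(C, x, y) \<in> W" for C x y
    proof -
      have "x \<in> C \<inter> F" "y \<in> C \<inter> F" "x \<subseteq> y" using that by (auto simp: W_def windows_def)
      then show ?thesis unfolding conjunct2[OF key[OF that]] by blast
    qed
    have xy: "x = x'" "y = y'" using ends[OF w(1)] ends[OF w(2)] eq by simp_all
    have "(`) (l x) ` (`) (u y) ` f (C, x, y) = C" "(`) (l x) ` (`) (u y) ` f (C', x, y) = C'"
      unfolding f_def prod.case avoids_involution[OF u[OF w(1)]] avoids_involution[OF l[OF w(1)]]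
      by (rule refl)+
    then have "C = C'" using eq xy by metis
    then show "p = q" using xy p by simp
  qed
  moreover have "f ` W \<subseteq> {C \<in> T. card (C \<inter> F) = m}"
  proof (rule image_subsetI)
    fix p assume "p \<in> W"
    then obtain C x y where p: "p = (C, x, y)" and w: "(C, x, y) \<in> W" by (cases p) blast
    then have "card {z \<in> C \<inter> F. x \<subseteq> z \<and> z \<subseteq> y} = m" by (simp add: W_def windows_def)
    then show "f p \<in> {C \<in> T. card (C \<inter> F) = m}" using key[OF w] p by simp
  qed
  ultimately have WM: "card W \<le> card {C \<in> T. card (C \<inter> F) = m}"
    using finT by (intro card_inj_on_le) auto
  \<comment> \<open>As \<open>k = Suc m\<close>, a chain with exactly \<open>m\<close> members in
    \<open>F\<close> has one unit to spare; these units pay for the windows.\<close>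
  have "card (C \<inter> F) + (if card (C \<inter> F) = m then 1 else 0) \<le>
    k + card {(x, y) \<in> windows m (C \<inter> F). \<exists>f\<in>C \<inter> F. f \<subset> x}" if "C \<in> T" for C
    using card_le_windows(2)[OF fin chain_subset_mono[OF chain[OF that] Int_lower1] m(1)] m by auto
  then have "(\<Sum>C\<in>T. card (C \<inter> F) + (if card (C \<inter> F) = m then 1 else 0)) \<le>
    (\<Sum>C\<in>T. k + card {(x, y) \<in> windows m (C \<inter> F). \<exists>f\<in>C \<inter> F. f \<subset> x})"
    by (rule sum_mono)
  moreover have "(\<Sum>C\<in>T. if card (C \<inter> F) = m then 1 else 0) = card {C \<in> T. card (C \<inter> F) = m}"
    using finT by (simp add: sum.If_cases Int_def)
  moreover have "finite {(x, y) \<in> windows m (C \<inter> F). \<exists>f\<in>C \<inter> F. f \<subset> x}" for C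
    by (rule finite_subset[OF _ finite_windows[OF fin, of m]]) auto
  then have "card W = (\<Sum>C\<in>T. card {(x, y) \<in> windows m (C \<inter> F). \<exists>f\<in>C \<inter> F. f \<subset> x})"
    unfolding W_def using finT by (intro card_SigmaI) auto
  ultimately show ?thesis using WM unfolding T_def by (simp add: sum.distrib mult.commute[of k])
qed

subsection \<open>The largest binomial coefficients\<close>

text \<open>This passes from values to a set \<open>K\<close> of levels: sorting the indices by
  their coefficient keeps equal coefficients of different levels apart.\<close>

lemma sum_largest_binomials_levels:
  assumes "k \<le> Suc n"
  obtains K where "K \<subseteq> {..n}" "card K = k" "sum_largest_binomials n k = (\<Sum>i\<in>K. n choose i)"
    "\<And>i j. i \<in> K \<Longrightarrow> j \<in> {..n} - K \<Longrightarrow> n choose j \<le> n choose i"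
proof -
  define f where "f i = n choose i" for i
  define ys where "ys = rev (sort_key f [0..<Suc n])"
  have "sort (map f [0..<Suc n]) = map f (sort_key f [0..<Suc n])"
    by (rule properties_for_sort) (simp_all add: mset_map)
  then have eq: "rev (sort (map f [0..<Suc n])) = map f ys" by (simp add: ys_def rev_map)
  have ys: "distinct ys" "set ys = {..n}" "length ys = Suc n"
    by (auto simp: ys_def atLeast0LessThan lessThan_Suc_atMost simp del: upt_Suc)
  have sorted: "sorted_wrt (\<lambda>i j. f j \<le> f i) ys"
    unfolding ys_def sorted_wrt_rev using sorted_sort_key[of f] by (simp add: sorted_wrt_map)
  define K where "K = set (take k ys)"
  show thesis
  proof
    show "K \<subseteq> {..n}" unfolding K_def using ys(2) set_take_subset by fastforce
    show "card K = k" unfolding K_def using ys assms by (subst distinct_card) auto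
    show "sum_largest_binomials n k = (\<Sum>i\<in>K. n choose i)"
      unfolding sum_largest_binomials_def f_def[symmetric] eq K_def take_map
      using ys(1) by (subst sum_list_distinct_conv_sum_set) auto
    fix i j assume i: "i \<in> K" and j: "j \<in> {..n} - K"
    have "set ys = set (take k ys) \<union> set (drop k ys)" by (metis append_take_drop_id set_append)
    then have "j \<in> set (drop k ys)" using j ys(2) by (auto simp: K_def)
    moreover have "sorted_wrt (\<lambda>i j. f j \<le> f i) (take k ys @ drop k ys)" using sorted by simp
    ultimately show "n choose j \<le> n choose i"
      using i unfolding sorted_wrt_append K_def f_def by blast
  qed
qed

text \<open>In the application \<open>K\<close> consists of the levels with the largest binomial coefficients and \<open>c\<close> is the
  smallest of these; every unit of weight missing from \<open>card K\<close> then costs \<open>c\<close> sets.\<close>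

lemma weighted_level_bound:
  assumes "finite X" "F \<subseteq> Pow X" "K \<subseteq> {..card X}"
    and "\<And>i. i \<in> K \<Longrightarrow> c \<le> real (card X choose i)"
    and "\<And>j. j \<in> {..card X} - K \<Longrightarrow> real (card X choose j) \<le> c"
  shows "real (card F) \<le> (\<Sum>i\<in>K. real (card X choose i)) +
    c * ((\<Sum>A\<in>F. 1 / real (card X choose card A)) - real (card K))"
proof -
  define n where "n = card X"
  define b where "b i = real (n choose i)" for i
  define L where "L i = {A\<in>F. card A = i}" for i
  define t where "t i = real (card (L i)) / b i" for i
  have finF: "finite F" using assms(1,2) finite_subset by blast
  have bpos: "b i > 0" if "i \<le> n" for i using that by (simp add: b_def)
  have t: "0 \<le> t i" "t i \<le> 1" if "i \<le> n" for i
  proof -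
    show "0 \<le> t i" by (simp add: t_def b_def)
    have "card (L i) \<le> card {A. A \<subseteq> X \<and> card A = i}"
      using assms(1,2) by (intro card_mono) (auto simp: L_def)
    then show "t i \<le> 1" using n_subsets[OF assms(1), of i] bpos[OF that]
      by (simp add: t_def b_def n_def)
  qed
  have rng: "card ` F \<subseteq> {..n}" using assms(1,2) by (auto simp: n_def intro: card_mono)
  have group: "(\<Sum>A\<in>F. g (card A)) = (\<Sum>i\<le>n. real (card (L i)) * g i)" for g :: "nat \<Rightarrow> real"
  proof -
    have "(\<Sum>A\<in>F. g (card A)) = (\<Sum>i\<le>n. \<Sum>A\<in>L i. g (card A))"
      unfolding L_def by (rule sum.group[symmetric]) (use finF rng in auto)
    also have "\<dots> = (\<Sum>i\<le>n. real (card (L i)) * g i)" by (intro sum.cong refl) (simp add: L_def)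
    finally show ?thesis .
  qed
  have w: "(\<Sum>A\<in>F. 1 / real (card X choose card A)) = (\<Sum>i\<le>n. t i)"
    using group[of "\<lambda>i. 1 / b i"] by (simp add: t_def b_def n_def)
  have cF: "real (card F) = (\<Sum>i\<le>n. b i * t i)"
  proof -
    have "b i * t i = real (card (L i))" if "i \<le> n" for i using bpos[OF that] by (simp add: t_def)
    then show ?thesis using group[of "\<lambda>i. 1"] by simp
  qed
  have split: "(\<Sum>i\<le>n. g i) = (\<Sum>i\<in>K. g i) + (\<Sum>i\<in>{..n} - K. g i)" for g :: "nat \<Rightarrow> real"
    using assms(3) by (simp add: n_def sum.subset_diff add.commute)
  \<comment> \<open>Here \<open>t i\<close> is the fraction of level \<open>i\<close> inside
    \<open>F\<close>. It lies between 0 and 1, and \<open>b i - c\<close> is nonnegative on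
    \<open>K\<close> and nonpositive off \<open>K\<close>; expanding the products gives the
    bound.\<close>
  have "0 \<le> (\<Sum>i\<in>K. (b i - c) * (1 - t i)) + (\<Sum>i\<in>{..n} - K. (c - b i) * t i)"
    using assms(3-5) t by (intro add_nonneg_nonneg sum_nonneg mult_nonneg_nonneg) (auto simp: b_def n_def)
  also have "\<dots> = (\<Sum>i\<in>K. b i) + c * ((\<Sum>i\<le>n. t i) - real (card K)) - (\<Sum>i\<le>n. b i * t i)"
    unfolding split[of t] split[of "\<lambda>i. b i * t i"]
    by (simp add: algebra_simps sum.distrib sum_subtractf sum_distrib_left)
  finally show ?thesis unfolding w cF by (simp add: b_def n_def)
qed

lemma binomial_ge_2: "0 < i \<Longrightarrow> i < n \<Longrightarrow> n choose i \<ge> 2"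
proof -
  assume i: "0 < i" "i < n"
  then obtain m l where "n = Suc m" "i = Suc l" by (metis not0_implies_Suc not_less0 less_imp_Suc_add)
  moreover then have "m choose l > 0" "m choose Suc l > 0" using i by auto
  then have "2 \<le> (m choose l) + (m choose Suc l)" by linarith
  ultimately show ?thesis by simp
qed

text \<open>Off the middle, the mirror level \<open>n - i\<close> has the same coefficient. In the
  middle, passing to \<open>i + 1\<close> multiplies the coefficient by \<open>i / (i + 1)\<close>,
  which exceeds 1/2 because \<open>n \<ge> 3\<close> forces \<open>i \<ge> 2\<close>.\<close>

lemma binomial_less_double_other:
  assumes "n \<ge> 3" "i \<le> n"
  shows "\<exists>j\<le>n. j \<noteq> i \<and> n choose i < 2 * (n choose j)"
proof (cases "n = 2 * i")
  case False
  then show ?thesis using assms binomial_symmetric[OF assms(2)]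
    by (intro exI[of _ "n - i"]) auto
next
  case True
  then have i: "i \<ge> 2" using assms(1) by simp
  have "Suc i * (n choose Suc i) = (n choose i) * (n - i)"
    using binomial_absorb_comp[of n i] binomial_absorption[of i n] by (metis mult.commute)
  then have eq: "Suc i * (n choose Suc i) = i * (n choose i)" using True by simp
  have pos: "n choose i > 0" using assms(2) by simp
  have "Suc i * (n choose i) < 2 * i * (n choose i)" using i pos by (intro mult_strict_right_mono) auto
  also have "\<dots> = Suc i * (2 * (n choose Suc i))" using eq by simp
  finally have "n choose i < 2 * (n choose Suc i)" by (simp only: mult_less_cancel1)
  then show ?thesis using True i by (intro exI[of _ "Suc i"]) auto
qed

text \<open>The level \<open>i\<close> has the smallest coefficient among the \<open>k\<close>
  chosen levels. The lower bound 2 and the two facts for \<open>k = 2\<close> provide room for the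
  empty and the full set.\<close>

lemma level_bound:
  assumes "finite X" "card X = n" "1 \<le> k" "k + 1 \<le> n"
  obtains i where "i \<le> n" "n choose i \<ge> 2"
    "\<And>F. F \<subseteq> Pow X \<Longrightarrow> real (card F) \<le> real (sum_largest_binomials n k) +
       real (n choose i) * ((\<Sum>A\<in>F. 1 / real (n choose card A)) - real k)"
    "\<And>j. k = 2 \<Longrightarrow> j \<le> n \<Longrightarrow> n choose j < 2 * (n choose i)"
    "k = 2 \<Longrightarrow> n + 2 \<le> sum_largest_binomials n k"
proof -
  obtain K where K: "K \<subseteq> {..n}" "card K = k" "sum_largest_binomials n k = (\<Sum>i\<in>K. n choose i)"
    "\<And>i j. i \<in> K \<Longrightarrow> j \<in> {..n} - K \<Longrightarrow> n choose j \<le> n choose i"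
    using sum_largest_binomials_levels[of k n] assms(4) by auto
  have finK: "finite K" using K(1) finite_subset by blast
  have "K \<noteq> {}" using K(2) assms(3) by auto
  then obtain i where i: "i \<in> K" "\<And>j. j \<in> K \<Longrightarrow> n choose i \<le> n choose j"
    using ex_min_if_finite[of "(\<lambda>i. n choose i) ` K"] finK by (auto simp: not_less)
  have i_n: "i \<le> n" using i K by auto
  have ge2: "n choose i \<ge> 2"
  proof (rule ccontr)
    assume small: "\<not> n choose i \<ge> 2"
    \<comment> \<open>All \<open>n - 1\<close> inner levels have larger coefficients than the end
      level \<open>i\<close> and so belong to \<open>K\<close>, which then has at least
      \<open>n\<close> elements, more than \<open>k\<close>.\<close>
    have "j \<in> K" if "0 < j" "j < n" for j
      using K(4)[OF i(1), of j] binomial_ge_2[OF that] small that by fastforce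
    then have "{0<..<n} \<subseteq> K" by auto
    moreover have "i \<notin> {0<..<n}" using binomial_ge_2[of i n] small by auto
    ultimately have "card (insert i {0<..<n}) \<le> k"
      using i(1) finK K(2) by (metis card_mono insert_subset)
    then show False using assms(4) \<open>i \<notin> {0<..<n}\<close> by simp
  qed
  have dbl: "n choose j < 2 * (n choose i)" if k: "k = 2" and jn: "j \<le> n" for j
  proof (cases "n choose j \<le> n choose i")
    case True
    then show ?thesis using ge2 by linarith
  next
    case False
    then have "j \<in> K" "j \<noteq> i" using K(4)[OF i(1), of j] jn by auto
    \<comment> \<open>A level other than \<open>j\<close> is then \<open>i\<close> or lies outside
      \<open>K\<close>, so its coefficient is at most that of \<open>i\<close>; it suffices to find
      one with more than half the coefficient of \<open>j\<close>.\<close>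
    then have "K = {i, j}" using i(1) K(2) k finK by (intro card_seteq[symmetric]) auto
    moreover have "3 \<le> n" using k assms(4) by simp
    then obtain j' where j': "j' \<le> n" "j' \<noteq> j" "n choose j < 2 * (n choose j')"
      using binomial_less_double_other[of n j] jn by blast
    ultimately have "n choose j' \<le> n choose i" using K(4)[OF i(1), of j'] by (cases "j' = i") auto
    then show ?thesis using j'(3) by linarith
  qed
  have big: "n + 2 \<le> sum_largest_binomials n k" if k: "k = 2"
  proof -
    have "card (K - {i}) = 1" using K(2) k i(1) finK by simp
    then obtain j where "K - {i} = {j}" by (auto simp: card_1_singleton_iff)
    then have j: "j \<noteq> i" "K = {i, j}" using i(1) by blast+
    have S: "sum_largest_binomials n k = (n choose i) + (n choose j)" using j K(3) by simp
    show ?thesis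
    proof (cases "1 \<in> K")
      case True
      then show ?thesis using S j ge2 i(2)[of j] by auto
    next
      case False
      then have "n choose 1 \<le> n choose i" "n choose 1 \<le> n choose j"
        using K(4)[of _ 1] j assms(4) by auto
      then show ?thesis using S assms(4) k by simp
    qed
  qed
  have "real (card F) \<le> real (sum_largest_binomials n k) +
       real (n choose i) * ((\<Sum>A\<in>F. 1 / real (n choose card A)) - real k)" if "F \<subseteq> Pow X" for F
    using weighted_level_bound[OF assms(1) that, of K "real (n choose i)"] K i assms(2) by simp
  then show thesis using that i_n ge2 dbl big by blast
qed

section \<open>Size bounds, according to whether the family contains the empty and the full
  set\<close>

text \<open>Putting the empty set under a chain of \<open>j\<close> members of \<open>G\<close>
  gives a chain of \<open>j + 1\<close> members of \<open>F\<close> with the same top.\<close>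

lemma fork_free_insert_bot:
  assumes "fork_free (Suc j) F" "{} \<in> F" "G \<subseteq> F" "{} \<notin> G" "j \<ge> 1"
  shows "fork_free j G"
  unfolding fork_free_def
proof (intro allI impI)
  fix S y assume S: "S \<subseteq> G" "chain\<^sub>\<subseteq> S" "card S = j" "y \<in> S" "\<forall>s\<in>S. s \<subseteq> y"
  have "finite S" using S(3) assms(5) by (intro card_ge_0_finite) simp
  moreover have "{} \<notin> S" using S(1) assms(4) by blast
  ultimately have "card (insert {} S) = Suc j" using S(3) by simp
  moreover have "chain\<^sub>\<subseteq> (insert {} S)" using S(2) by (auto simp: chain_subset_def)
  moreover have "insert {} S \<subseteq> F" "y \<in> insert {} S" "\<forall>s\<in>insert {} S. s \<subseteq> y"
    using S assms(2,3) by blast+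
  ultimately have "chain\<^sub>\<subseteq> {h\<in>F. y \<subset> h}" using assms(1) unfolding fork_free_def by blast
  then show "chain\<^sub>\<subseteq> {h\<in>G. y \<subset> h}" by (rule chain_subset_mono) (use assms(3) in blast)
qed

lemma cofork_free_insert_top:
  assumes "cofork_free (Suc j) F" "F \<subseteq> Pow X" "X \<in> F" "G \<subseteq> F" "X \<notin> G" "j \<ge> 1"
  shows "cofork_free j G"
  unfolding cofork_free_def
proof (intro allI impI)
  fix S x assume S: "S \<subseteq> G" "chain\<^sub>\<subseteq> S" "card S = j" "x \<in> S" "\<forall>s\<in>S. x \<subseteq> s"
  have "finite S" using S(3) assms(6) by (intro card_ge_0_finite) simp
  moreover have "X \<notin> S" using S(1) assms(5) by blast
  ultimately have "card (insert X S) = Suc j" using S(3) by simp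
  moreover have le: "\<forall>s\<in>S. s \<subseteq> X" using S(1) assms(2,4) by blast
  then have "chain\<^sub>\<subseteq> (insert X S)" using S(2) by (auto simp: chain_subset_def)
  moreover have "insert X S \<subseteq> F" "x \<in> insert X S" "\<forall>s\<in>insert X S. x \<subseteq> s"
    using S assms(3,4) le by blast+
  ultimately have "chain\<^sub>\<subseteq> {h\<in>F. h \<subset> x}" using assms(1) unfolding cofork_free_def by blast
  then show "chain\<^sub>\<subseteq> {h\<in>G. h \<subset> x}" by (rule chain_subset_mono) (use assms(4) in blast)
qed

text \<open>Maximal members of \<open>G\<close> are pairwise incomparable, so a full chain holds at
  most one element of \<open>Y\<close>, and then it is one of the chains \<open>M\<close> that count
  as deficit. Dividing by the number of full chains yields weights.\<close>

lemma fork_free_weight: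
  assumes "finite X" "G \<subseteq> Pow X" "X \<notin> G" "fork_free j G" "j \<ge> 1"
    and "finite Y" "Y \<subseteq> {y\<in>G. \<forall>h\<in>G. \<not> y \<subset> h}"
  shows "(\<Sum>A\<in>G. 1 / real (card X choose card A)) + (\<Sum>y\<in>Y. 1 / real (card X choose card y)) \<le> real j + 1"
proof -
  define T where "T = full_chains X"
  define M where "M = {C \<in> T. \<exists>y\<in>C \<inter> G. \<forall>h\<in>G. \<not> y \<subset> h}"
  have T: "finite T" "card T > 0"
    using assms(1) full_chains_nonempty[OF assms(1)] by (auto simp: T_def card_gt_0_iff)
  have "card (C \<inter> Y) \<le> (if C \<in> M then 1 else 0)" if "C \<in> T" for C
  proof -
    have "A = B" if AB: "A \<in> C \<inter> Y" "B \<in> C \<inter> Y" for A B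
    proof -
      have "A \<subseteq> B \<or> B \<subseteq> A" using AB \<open>C \<in> T\<close> by (auto simp: T_def full_chains_def chain_subset_def)
      moreover have "\<not> A \<subset> B" "\<not> B \<subset> A" using AB assms(7) by blast+
      ultimately show ?thesis by blast
    qed
    then have "card (C \<inter> Y) \<le> 1" by (metis One_nat_def card_le_Suc0_iff_eq assms(6) finite_Int)
    moreover have "C \<inter> Y = {}" if "C \<notin> M" using that \<open>C \<in> T\<close> assms(7) unfolding M_def by blast
    ultimately show ?thesis by auto
  qed
  then have "(\<Sum>C\<in>T. card (C \<inter> Y)) \<le> (\<Sum>C\<in>T. if C \<in> M then 1 else 0)" by (rule sum_mono)
  also have "\<dots> = card M" using T(1) by (simp add: sum.If_cases M_def Int_def)
  finally have "(\<Sum>C\<in>T. card (C \<inter> G)) + (\<Sum>C\<in>T. card (C \<inter> Y)) \<le> Suc j * card T"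
    using fork_free_chain_count[OF assms(1-5)] unfolding T_def M_def by linarith
  then have "real (\<Sum>C\<in>T. card (C \<inter> G)) + real (\<Sum>C\<in>T. card (C \<inter> Y)) \<le> real (Suc j) * real (card T)"
    by (metis of_nat_add of_nat_le_iff of_nat_mult)
  moreover have "Y \<subseteq> Pow X" using assms(2,7) by blast
  ultimately have "real (card T) * ((\<Sum>A\<in>G. 1 / real (card X choose card A)) +
    (\<Sum>y\<in>Y. 1 / real (card X choose card y))) \<le> real (card T) * (real j + 1)"
    using sum_card_chain_Int[OF assms(1,2)] sum_card_chain_Int[OF assms(1), of Y]
    unfolding T_def by (simp add: algebra_simps)
  then show ?thesis using T(2) by (simp only: mult_le_cancel_left_pos of_nat_0_less_iff)
qed

lemma fork_cofork_free_weight: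
  assumes "finite X" "F \<subseteq> Pow X" "X \<notin> F" "{} \<notin> F" "fork_free k F" "cofork_free k F" "k \<ge> 2"
  shows "(\<Sum>A\<in>F. 1 / real (card X choose card A)) \<le> real k"
proof -
  define T where "T = full_chains X"
  have T: "card T > 0"
    using assms(1) full_chains_nonempty[OF assms(1)] by (auto simp: T_def card_gt_0_iff)
  have "real (\<Sum>C\<in>T. card (C \<inter> F)) \<le> real (k * card T)"
    using fork_cofork_free_chain_count[OF assms] unfolding T_def by (simp only: of_nat_le_iff)
  then have "real (card T) * (\<Sum>A\<in>F. 1 / real (card X choose card A)) \<le> real (card T) * real k"
    using sum_card_chain_Int[OF assms(1,2)] unfolding T_def by (simp add: mult.commute)
  then show ?thesis using T by (simp only: mult_le_cancel_left_pos of_nat_0_less_iff)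
qed

lemma ex_maximal_above:
  assumes "finite G" "g \<in> G"
  shows "\<exists>y\<in>G. g \<subseteq> y \<and> (\<forall>h\<in>G. \<not> y \<subset> h)"
proof -
  obtain y where "y \<in> G" "g \<subseteq> y" "\<forall>h\<in>G. y \<subseteq> h \<longrightarrow> y = h"
    using finite_has_maximal2[OF assms] by (elim bexE conjE)
  then show ?thesis by (intro bexI[of _ y]) auto
qed

text \<open>Without the empty set the family is fork-free for \<open>k - 1\<close>, and a maximal
  member of \<open>G\<close> makes its weight strictly less than \<open>k\<close>. The bound for
  \<open>G\<close> is then strict, which leaves room for the empty set.\<close>

lemma card_fork_free_with_bot:
  assumes "finite X" "card X = n" "k \<ge> 2" "n \<ge> k + 1" "F \<subseteq> Pow X" "fork_free k F" "{} \<in> F" "X \<notin> F"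
  shows "card F \<le> sum_largest_binomials n k"
proof -
  have finF: "finite F" using assms(1,5) finite_subset by blast
  obtain i where i: "i \<le> n" "n choose i \<ge> 2"
    "\<And>F. F \<subseteq> Pow X \<Longrightarrow> real (card F) \<le> real (sum_largest_binomials n k) +
       real (n choose i) * ((\<Sum>A\<in>F. 1 / real (n choose card A)) - real k)"
    by (rule level_bound[of X n k]) (use assms in auto)
  define G where "G = F - {{}}"
  have G: "G \<subseteq> Pow X" "X \<notin> G" using assms by (auto simp: G_def)
  obtain j where j: "k = Suc j" "j \<ge> 1" using assms(3) by (cases k) auto
  have free: "fork_free j G"
    by (rule fork_free_insert_bot[of j F]) (use assms j in \<open>auto simp: G_def\<close>)
  have "(\<Sum>A\<in>G. 1 / real (n choose card A)) < real k"
  proof (cases "G = {}")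
    case True
    then show ?thesis using assms(3) by simp
  next
    case False
    then obtain y where y: "y \<in> G" "\<forall>h\<in>G. \<not> y \<subset> h"
      using ex_maximal_above[of G] finF unfolding G_def by (metis all_not_in_conv finite_Diff)
    have "(\<Sum>A\<in>G. 1 / real (card X choose card A)) + (\<Sum>y\<in>{y}. 1 / real (card X choose card y)) \<le> real j + 1"
      by (rule fork_free_weight[OF assms(1) G free j(2)]) (use y in auto)
    moreover have "card y \<le> n" using y G assms(1,2) by (metis PowD card_mono subsetD)
    then have "1 / real (n choose card y) > 0" by simp
    ultimately show ?thesis unfolding j(1) assms(2) by (simp del: zero_less_divide_1_iff)
  qed
  then have "real (n choose i) * ((\<Sum>A\<in>G. 1 / real (n choose card A)) - real k) < 0"
    using i(1) by (intro mult_pos_neg) auto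
  then have "card G < sum_largest_binomials n k" using i(3)[OF G(1)] by linarith
  moreover have "card F = Suc (card G)" unfolding G_def using finF assms(7) by (metis card_Suc_Diff1)
  ultimately show ?thesis by simp
qed

text \<open>The bound for \<open>G\<close> must improve by 2 to make up for both removed sets. The
  case \<open>k = 2\<close> is separate because the argument with two swaps is applied to
  \<open>k - 1\<close> and needs at least 2 there.\<close>

lemma card_fork_cofork_free_with_bot_top:
  assumes "finite X" "card X = n" "k \<ge> 2" "n \<ge> k + 1" "F \<subseteq> Pow X" "fork_free k F" "cofork_free k F"
    "{} \<in> F" "X \<in> F"
  shows "card F \<le> sum_largest_binomials n k"
proof -
  have finF: "finite F" using assms(1,5) finite_subset by blast
  obtain i where i: "i \<le> n" "n choose i \<ge> 2"
    "\<And>F. F \<subseteq> Pow X \<Longrightarrow> real (card F) \<le> real (sum_largest_binomials n k) +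
       real (n choose i) * ((\<Sum>A\<in>F. 1 / real (n choose card A)) - real k)"
    "\<And>j. k = 2 \<Longrightarrow> j \<le> n \<Longrightarrow> n choose j < 2 * (n choose i)"
    "k = 2 \<Longrightarrow> n + 2 \<le> sum_largest_binomials n k"
    by (rule level_bound[of X n k]) (use assms in auto)
  define G where "G = F - {{}, X}"
  have finG: "finite G" using finF by (simp add: G_def)
  have G: "G \<subseteq> Pow X" "X \<notin> G" "{} \<notin> G" using assms by (auto simp: G_def)
  obtain j where j: "k = Suc j" "j \<ge> 1" using assms(3) by (cases k) auto
  have free: "fork_free j G" "cofork_free j G"
    using fork_free_insert_bot[of j F G] cofork_free_insert_top[of j F X G] assms j
    by (auto simp: G_def)
  have "card G + 2 \<le> sum_largest_binomials n k"
  proof (cases "k = 2")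
    case False
    then have "(\<Sum>A\<in>G. 1 / real (n choose card A)) \<le> real j"
      using fork_cofork_free_weight[OF assms(1) G free] j assms(2,3) by simp
    \<comment> \<open>The missing unit of weight costs the coefficient of level \<open>i\<close>,
      which is at least 2.\<close>
    then have "real (n choose i) * ((\<Sum>A\<in>G. 1 / real (n choose card A)) - real k) \<le> real (n choose i) * (-1)"
      using j(1) by (intro mult_left_mono) auto
    then show ?thesis using i(3)[OF G(1)] i(2) by linarith
  next
    case True
    then have j1: "j = 1" using j by simp
    have card_le: "card A \<le> n" if "A \<in> G" for A using that G assms(1,2) by (metis PowD card_mono subsetD)
    show ?thesis
    proof (cases "\<exists>y\<in>G. \<exists>y'\<in>G. y \<noteq> y' \<and> (\<forall>h\<in>G. \<not> y \<subset> h) \<and> (\<forall>h\<in>G. \<not> y' \<subset> h)")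
      case True
      \<comment> \<open>Two maximal members each weigh more than half of \<open>1 / b\<close>, so
        the deficit exceeds \<open>1 / b\<close> and \<open>card G\<close> falls short by more than
        1, hence by at least 2.\<close>
      then obtain y y' where y: "y \<in> G" "y' \<in> G" "y \<noteq> y'" "\<forall>h\<in>G. \<not> y \<subset> h" "\<forall>h\<in>G. \<not> y' \<subset> h" by blast
      define b where "b = real (n choose i)"
      have b: "b > 0" using i(1) by (simp add: b_def)
      have inv: "1 / real (n choose card A) > 1 / (2 * b)" if "A \<in> G" for A
      proof -
        have "real (n choose card A) < 2 * b"
          using i(4)[OF \<open>k = 2\<close> card_le[OF that]] unfolding b_def by linarith
        moreover have "real (n choose card A) > 0" using card_le[OF that] by simp
        ultimately show ?thesis by (intro divide_strict_left_mono) auto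
      qed
      have "(\<Sum>A\<in>G. 1 / real (card X choose card A)) + (\<Sum>y\<in>{y, y'}. 1 / real (card X choose card y)) \<le> real j + 1"
        by (rule fork_free_weight[OF assms(1) G(1,2) free(1) j(2)]) (use y in auto)
      then have "(\<Sum>A\<in>G. 1 / real (n choose card A)) +
        (1 / real (n choose card y) + 1 / real (n choose card y')) \<le> real k"
        using y(3) j(1) assms(2) by simp
      moreover have "1 / b = 1 / (2 * b) + 1 / (2 * b)" using b by simp
      ultimately have "(\<Sum>A\<in>G. 1 / real (n choose card A)) + 1 / b < real k"
        using inv[OF y(1)] inv[OF y(2)] by linarith
      then have "b * ((\<Sum>A\<in>G. 1 / real (n choose card A)) - real k) < b * (- 1 / b)"
        using b by (intro mult_strict_left_mono) auto
      then show ?thesis using i(3)[OF G(1)] b unfolding b_def[symmetric] by simp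
    next
      case False
      \<comment> \<open>With at most one maximal member \<open>y\<close>, \<open>G\<close> is a
        chain: \<open>{y}\<close> is a chain of one member, so \<open>cofork_free 1\<close> makes
        the members strictly below \<open>y\<close> a chain. Hence \<open>G\<close> has at most
        \<open>n\<close> members.\<close>
      have "g \<subseteq> h \<or> h \<subseteq> g" if gh: "g \<in> G" "h \<in> G" for g h
      proof -
        obtain y where y: "y \<in> G" "g \<subseteq> y" "\<forall>h\<in>G. \<not> y \<subset> h"
          using ex_maximal_above[OF finG gh(1)] by blast
        obtain y' where y': "y' \<in> G" "h \<subseteq> y'" "\<forall>h\<in>G. \<not> y' \<subset> h"
          using ex_maximal_above[OF finG gh(2)] by blast
        have "y = y'" using False y y' by metis
        have c: "chain\<^sub>\<subseteq> {h\<in>G. h \<subset> y}"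
          using free(2)[unfolded cofork_free_def, rule_format, of "{y}" y] y(1) j1
          by (simp add: chain_subset_def)
        consider "g = y" | "h = y" | "g \<in> {h\<in>G. h \<subset> y}" "h \<in> {h\<in>G. h \<subset> y}"
          using y(2) y'(2) gh \<open>y = y'\<close> by auto
        then show ?thesis using y(2) y'(2) \<open>y = y'\<close> chain_subsetD[OF c] by cases simp_all
      qed
      then have "inj_on card G"
        by (intro card_inj_on_chain[OF _ G(1) assms(1)]) (simp add: chain_subset_def)
      moreover have "card A \<noteq> 0" if "A \<in> G" for A
        using that G assms(1) by (metis PowD card_0_eq finite_subset subsetD)
      then have "card ` G \<subseteq> {1..n}" using card_le by (fastforce simp: Suc_le_eq)
      ultimately have "card G \<le> n" by (metis card_atLeastAtMost card_inj_on_le diff_Suc_1 finite_atLeastAtMost)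
      then show ?thesis using i(5)[OF \<open>k = 2\<close>] by simp
    qed
  qed
  moreover have "F = insert {} (insert X G)" using assms(8,9) by (auto simp: G_def)
  then have "card F \<le> card G + 2" by (simp add: card_insert_if finG)
  ultimately show ?thesis by simp
qed

text \<open>Complementation reduces the case of the full set alone to that of the empty set alone;
  the last hypothesis is for this case.\<close>

lemma card_fork_cofork_free:
  assumes "finite X" "card X = n" "k \<ge> 2" "n \<ge> k + 1" "F \<subseteq> Pow X" "fork_free k F" "cofork_free k F"
    "fork_free k ((-) X ` F)"
  shows "card F \<le> sum_largest_binomials n k"
proof -
  consider "{} \<in> F" "X \<in> F" | "{} \<in> F" "X \<notin> F" | "{} \<notin> F" "X \<in> F" | "{} \<notin> F" "X \<notin> F" by blast
  then show ?thesis
  proof cases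
    case 1
    then show ?thesis using card_fork_cofork_free_with_bot_top assms by blast
  next
    case 2
    then show ?thesis using card_fork_free_with_bot assms by blast
  next
    case 3
    have bot: "{} \<in> (-) X ` F" using 3 by (metis Diff_cancel imageI)
    have top: "X \<notin> (-) X ` F"
    proof
      assume "X \<in> (-) X ` F"
      then obtain A where "A \<in> F" "X = X - A" by blast
      moreover then have "A = {}" using assms(5) by blast
      ultimately show False using 3 by simp
    qed
    have "(-) X ` F \<subseteq> Pow X" by blast
    then have "card ((-) X ` F) \<le> sum_largest_binomials n k"
      using card_fork_free_with_bot[OF assms(1-4) _ assms(8) bot top] by simp
    moreover have "inj_on ((-) X) F" using assms(5) by (intro inj_onI) blast
    ultimately show ?thesis by (simp add: card_image)
  next
    case 4
    obtain i where i:
      "\<And>F. F \<subseteq> Pow X \<Longrightarrow> real (card F) \<le> real (sum_largest_binomials n k) +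
         real (n choose i) * ((\<Sum>A\<in>F. 1 / real (n choose card A)) - real k)"
      by (rule level_bound[of X n k]) (use assms in auto)
    have "(\<Sum>A\<in>F. 1 / real (n choose card A)) - real k \<le> 0"
      using fork_cofork_free_weight[OF assms(1,5) 4(2,1) assms(6,7,3)] assms(2) by simp
    then have "real (n choose i) * ((\<Sum>A\<in>F. 1 / real (n choose card A)) - real k) \<le> 0"
      by (simp add: mult_nonneg_nonpos)
    then show ?thesis using i[OF assms(5)] by linarith
  qed
qed

subsection \<open>Induced copies of the forbidden posets\<close>

text \<open>Two incomparable members above the top of a chain of \<open>k\<close> members would be
  the prongs of an induced copy whose stem is that chain.\<close>

lemma fork_free_if_no_Y:
  assumes "\<not> contains_induced (Y_poset k) F" "k \<ge> 1"
  shows "fork_free k F"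
  unfolding fork_free_def chain_subset_def
proof (intro allI impI ballI, rule ccontr)
  fix S y A B
  assume S: "S \<subseteq> F" "\<forall>A\<in>S. \<forall>B\<in>S. A \<subseteq> B \<or> B \<subseteq> A" "card S = k" "y \<in> S" "\<forall>s\<in>S. s \<subseteq> y"
    and AB: "A \<in> {h\<in>F. y \<subset> h}" "B \<in> {h\<in>F. y \<subset> h}" "\<not> (A \<subseteq> B \<or> B \<subseteq> A)"
  have "finite S" using S(3) assms(2) by (intro card_ge_0_finite) simp
  then obtain e where e: "bij_betw e {..<k} S"
    and lt: "\<And>i j. i < k \<Longrightarrow> j < k \<Longrightarrow> e i \<subset> e j \<longleftrightarrow> i < j"
    using enumerate_chain[of S] S(2,3) unfolding chain_subset_def by metis
  have eS: "e i \<in> F" "e i \<subset> A" "e i \<subset> B" if "i < k" for i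
  proof -
    have "e i \<in> S" using e that by (auto simp: bij_betw_def)
    then show "e i \<in> F" "e i \<subset> A" "e i \<subset> B" using S(1,5) AB by blast+
  qed
  have inj: "e i = e j \<longleftrightarrow> i = j" if "i < k" "j < k" for i j
    using e that by (auto simp: bij_betw_def inj_on_def)
  \<comment> \<open>Stems are numbered from 1, the enumeration \<open>e\<close> from 0; every prong
    index other than 1 goes to \<open>B\<close>.\<close>
  define \<alpha> where "\<alpha> p = (case p of Stem i \<Rightarrow> e (i - 1) | Prong j \<Rightarrow> if j = 1 then A else B)" for p
  have stem: "\<alpha> (Stem i) \<in> F" "\<alpha> (Stem i) \<subset> A" "\<alpha> (Stem i) \<subset> B" if "1 \<le> i" "i \<le> k" for i
    using eS[of "i - 1"] that by (simp_all add: \<alpha>_def)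
  have stems: "\<alpha> (Stem i) \<subset> \<alpha> (Stem j) \<longleftrightarrow> i < j" "\<alpha> (Stem i) = \<alpha> (Stem j) \<longleftrightarrow> i = j"
    if "1 \<le> i" "i \<le> k" "1 \<le> j" "j \<le> k" for i j
    using lt[of "i - 1" "j - 1"] inj[of "i - 1" "j - 1"] that by (auto simp: \<alpha>_def)
  have prong: "\<alpha> (Prong 1) = A" "\<alpha> (Prong 2) = B" by (simp_all add: \<alpha>_def)
  have fst: "p \<in> fst (Y_poset k) \<longleftrightarrow> (\<exists>i. 1 \<le> i \<and> i \<le> k \<and> p = Stem i) \<or> p = Prong 1 \<or> p = Prong 2" for p
    by (auto simp: Y_poset_def)
  have AB': "A \<in> F" "B \<in> F" "A \<noteq> B" "\<not> A \<subset> B" "\<not> B \<subset> A" using AB by blast+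
  have ne: "\<alpha> (Stem i) \<noteq> A" "\<alpha> (Stem i) \<noteq> B" "\<not> A \<subset> \<alpha> (Stem i)" "\<not> B \<subset> \<alpha> (Stem i)" if "1 \<le> i" "i \<le> k" for i
    using stem[OF that] by blast+
  have "contains_induced (Y_poset k) F"
    unfolding contains_induced_def
  proof (intro exI[of _ \<alpha>] conjI ballI)
    show "inj_on \<alpha> (fst (Y_poset k))"
      by (rule inj_onI) (auto simp: fst prong stems AB'(3) AB'(3)[symmetric] ne(1,2) ne(1,2)[symmetric] simp del: One_nat_def)
    show "\<alpha> ` fst (Y_poset k) \<subseteq> F"
      by (rule image_subsetI) (auto simp: fst prong AB'(1,2) stem(1) simp del: One_nat_def)
    fix p q assume "p \<in> fst (Y_poset k)" "q \<in> fst (Y_poset k)"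
    then show "(p, q) \<in> snd (Y_poset k) \<longleftrightarrow> \<alpha> p \<subset> \<alpha> q"
      unfolding fst by (elim disjE exE conjE)
        (simp_all add: prong stems stem AB' ne Y_poset_def image_iff del: One_nat_def)
  qed
  then show False using assms(1) by simp
qed

text \<open>Complements in \<open>X\<close> reverse strict inclusion, so the complements of a copy
  of \<open>P\<close> form a copy of its dual. This reduces \<open>Y'_k\<close> to
  \<open>Y_k\<close>.\<close>

lemma contains_induced_dual:
  assumes "F \<subseteq> Pow X" "contains_induced P ((-) X ` F)"
  shows "contains_induced (dual_poset P) F"
proof -
  obtain \<alpha> where \<alpha>: "inj_on \<alpha> (fst P)" "\<alpha> ` fst P \<subseteq> (-) X ` F"
    "\<forall>x\<in>fst P. \<forall>y\<in>fst P. (x, y) \<in> snd P \<longleftrightarrow> \<alpha> x \<subset> \<alpha> y"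
    using assms(2) unfolding contains_induced_def by (elim exE conjE)
  have sub: "\<alpha> x \<subseteq> X" "X - \<alpha> x \<in> F" if x: "x \<in> fst P" for x
  proof -
    obtain A where A: "A \<in> F" "\<alpha> x = X - A" using \<alpha>(2) x by blast
    then have "X - \<alpha> x = A" using assms(1) by blast
    then show "\<alpha> x \<subseteq> X" "X - \<alpha> x \<in> F" using A by auto
  qed
  have dist: "X - A = X - B \<longleftrightarrow> A = B" "X - A \<subset> X - B \<longleftrightarrow> B \<subset> A" if "A \<subseteq> X" "B \<subseteq> X" for A B
    using that by blast+
  show ?thesis
    unfolding contains_induced_def dual_poset_def fst_conv snd_conv
  proof (intro exI[of _ "\<lambda>x. X - \<alpha> x"] conjI ballI)
    show "inj_on (\<lambda>x. X - \<alpha> x) (fst P)"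
      using \<alpha>(1) sub(1) dist(1) unfolding inj_on_def by metis
    show "(\<lambda>x. X - \<alpha> x) ` fst P \<subseteq> F" using sub(2) by blast
    fix x y assume xy: "x \<in> fst P" "y \<in> fst P"
    show "(x, y) \<in> (snd P)\<inverse> \<longleftrightarrow> X - \<alpha> x \<subset> X - \<alpha> y"
      unfolding dist(2)[OF sub(1)[OF xy(1)] sub(1)[OF xy(2)]] using \<alpha>(3) xy by simp
  qed
qed

lemma cofork_free_if_compl_fork_free:
  assumes "F \<subseteq> Pow X" "fork_free k ((-) X ` F)"
  shows "cofork_free k F"
  unfolding cofork_free_def
proof (intro allI impI)
  fix S x assume S: "S \<subseteq> F" "chain\<^sub>\<subseteq> S" "card S = k" "x \<in> S" "\<forall>s\<in>S. x \<subseteq> s"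
  have inj: "inj_on ((-) X) S" using assms(1) S(1) by (intro inj_onI) blast
  have "(-) X ` S \<subseteq> (-) X ` F" "chain\<^sub>\<subseteq> ((-) X ` S)" "card ((-) X ` S) = k" "X - x \<in> (-) X ` S"
    "\<forall>s\<in>(-) X ` S. s \<subseteq> X - x"
    using S card_image[OF inj] by (auto simp: chain_subset_def)
  then have c: "chain\<^sub>\<subseteq> {h \<in> (-) X ` F. X - x \<subset> h}"
    using assms(2) unfolding fork_free_def by blast
  show "chain\<^sub>\<subseteq> {h\<in>F. h \<subset> x}"
    unfolding chain_subset_def
  proof (intro ballI)
    fix A B assume AB: "A \<in> {h\<in>F. h \<subset> x}" "B \<in> {h\<in>F. h \<subset> x}"
    have X: "A \<subseteq> X" "B \<subseteq> X" "x \<subseteq> X" using AB S(1,4) assms(1) by blast+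
    then have "X - A \<in> {h \<in> (-) X ` F. X - x \<subset> h}" "X - B \<in> {h \<in> (-) X ` F. X - x \<subset> h}"
      using AB by blast+
    then have "X - A \<subseteq> X - B \<or> X - B \<subseteq> X - A" by (rule chain_subsetD[OF c])
    then show "A \<subseteq> B \<or> B \<subseteq> A" using X by blast
  qed
qed

text \<open>Pairwise comparable elements are sent to a chain of sets, whose sizes are distinct
  elements of \<open>K\<close>. This serves the lower bound, where \<open>F\<close> is a union of
  levels.\<close>

lemma contains_induced_total_card_le:
  assumes "contains_induced P F" "Q \<subseteq> fst P" "finite K"
    and "\<And>p q. p \<in> Q \<Longrightarrow> q \<in> Q \<Longrightarrow> p \<noteq> q \<Longrightarrow> (p, q) \<in> snd P \<or> (q, p) \<in> snd P"
    and "\<And>A. A \<in> F \<Longrightarrow> finite A \<and> card A \<in> K"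
  shows "card Q \<le> card K"
proof -
  obtain \<alpha> where \<alpha>: "\<alpha> ` fst P \<subseteq> F"
    "\<forall>x\<in>fst P. \<forall>y\<in>fst P. (x, y) \<in> snd P \<longleftrightarrow> \<alpha> x \<subset> \<alpha> y"
    using assms(1) unfolding contains_induced_def by (elim exE conjE)
  have "inj_on (\<lambda>p. card (\<alpha> p)) Q"
  proof (rule inj_onI, rule ccontr)
    fix p q assume pq: "p \<in> Q" "q \<in> Q" "card (\<alpha> p) = card (\<alpha> q)" "p \<noteq> q"
    then have "\<alpha> p \<subset> \<alpha> q \<or> \<alpha> q \<subset> \<alpha> p" using assms(2,4) \<alpha>(2) by blast
    moreover have "finite (\<alpha> p)" "finite (\<alpha> q)" using assms(2,5) \<alpha>(1) pq by blast+
    ultimately show False using pq(3) by (metis less_irrefl psubset_card_mono)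
  qed
  moreover have "(\<lambda>p. card (\<alpha> p)) ` Q \<subseteq> K" using assms(2,5) \<alpha>(1) by blast
  ultimately show ?thesis using assms(3) by (rule card_inj_on_le)
qed

theorem theorem1p2:
  fixes k n :: nat
  assumes "k \<ge> 2" and "n \<ge> k + 1"
  shows "La_sharp n {Y_poset k, dual_poset (Y_poset k)} = sum_largest_binomials n k"
  unfolding La_sharp_def
proof (rule Max_eqI)
  let ?X = "{1..n}" and ?P = "{Y_poset k, dual_poset (Y_poset k)}"
  show "finite (card ` induced_free_families n ?P)"
    by (rule finite_imageI[OF finite_induced_free_families])
  show "m \<le> sum_largest_binomials n k" if m: "m \<in> card ` induced_free_families n ?P" for m
  proof -
    obtain F where F: "m = card F" "F \<subseteq> Pow ?X" "\<not> contains_induced (Y_poset k) F"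
      "\<not> contains_induced (dual_poset (Y_poset k)) F"
      using m by (auto simp: induced_free_families_def)
    have "fork_free k F" using F(3) assms by (intro fork_free_if_no_Y) auto
    moreover have "fork_free k ((-) ?X ` F)"
      using contains_induced_dual[OF F(2), of "Y_poset k"] F(4) assms by (intro fork_free_if_no_Y) auto
    ultimately show ?thesis
      using card_fork_cofork_free[of ?X n k F] cofork_free_if_compl_fork_free[OF F(2)] F(1,2) assms by simp
  qed
  obtain K where K: "K \<subseteq> {..n}" "card K = k" "sum_largest_binomials n k = (\<Sum>i\<in>K. n choose i)"
    using sum_largest_binomials_levels[of k n] assms(2) by auto
  have finK: "finite K" using K(1) finite_subset by blast
  define F where "F = (\<Union>i\<in>K. {A. A \<subseteq> ?X \<and> card A = i})"
  have "card F = (\<Sum>i\<in>K. card {A. A \<subseteq> ?X \<and> card A = i})"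
    unfolding F_def using finK by (intro card_UN_disjoint) auto
  also have "\<dots> = sum_largest_binomials n k" using n_subsets[of ?X] K(3) by simp
  finally have card: "card F = sum_largest_binomials n k" .
  have levels: "finite A \<and> card A \<in> K" if "A \<in> F" for A
    using that by (auto simp: F_def intro: finite_subset)
  \<comment> \<open>The elements \<open>x_1\<close>, ..., \<open>x_k\<close>, \<open>y_1\<close>
    form a chain of \<open>k + 1\<close> elements in \<open>Y_k\<close> and, reversed, in its dual:
    too long for \<open>k\<close> levels.\<close>
  define Q where "Q = insert (Prong 1) (Stem ` {1..k})"
  have "card (Stem ` {1..k}) = k" by (subst card_image) (auto simp: inj_on_def)
  then have Q: "card Q = Suc k" unfolding Q_def by (subst card_insert_disjoint) auto
  have "\<not> contains_induced P F" if "P \<in> ?P" for P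
  proof
    assume "contains_induced P F"
    then have "card Q \<le> card K"
      by (rule contains_induced_total_card_le[OF _ _ finK _ levels])
        (use that in \<open>auto simp: Q_def Y_poset_def dual_poset_def\<close>)
    then show False using Q K(2) by simp
  qed
  then have "F \<in> induced_free_families n ?P" by (auto simp: induced_free_families_def F_def)
  then show "sum_largest_binomials n k \<in> card ` induced_free_families n ?P" using card by force
qed

end
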